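(* Work in the basic setting described in the context, where in addition: $\tau$ is the first return time of $f$ to $Y$; $\psi$ is an admissible perturbation of heavy-tail type with exponent $\gamma\in(0,1]$; the uniform ratio condition (see context) holds; and $\mu_{\bar\phi}(\tau>n)=c\,n^{-\beta}(1+o(1))$ for some $\beta\in(0,1)$ and $c>0$. Let $\mathbb E_s(\tau)=\int_Y\tau\,d\mu_{\overline{\phi+s\psi}}$. Then, as $s\to0$ (with $s>0$), $$\mathbb E_s(\tau)\ge C_{\gamma,c}\,s^{(\beta-1)/\gamma}(1+o(1)),$$ where $C_{\gamma,c}>0$ is a constant depending on $\gamma$ and on the constant $c$.
   Context: Notation: $a\ll b$ means $a=O(b)$. Pressure: for a dynamical system $(X,f)$ and $\chi:X\to[-\infty,\infty)$, $P(\chi)=\sup\{h_\mu(f)+\int\chi\,d\mu\}$ over $f$-invariant probability measures $\mu$ with $-\int\chi\,d\mu<\infty$; for potentials on $Y$ the same with $F$ in place of $f$. Inducing: $Y\subset X$, $\tau:Y\to\mathbb N$ the first return time, $F=f^\tau:Y\to Y$. For $\chi:X\to[-\infty,\infty)$ the induced potential is $\bar\chi=\overline{\chi}=\sum_{j=0}^{\tau-1}\chi\circ f^j$. $F$ is a Markov map with countable Markov partition $\mathcal A=\{Y_i\}$ ($F$ injective and $\tau$ constant on each $Y_i$; for all $i,j$ either $Y_i\cap F(Y_j)=\emptyset$ or $Y_i\subset F(Y_j)$) with the big image and preimage (BIP) property: there is $N$ such that for each $i$ there are $a,b\in\{1,\dots,N\}$ with $F(Y_a)\cap Y_i\ne\emptyset\ne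 F(Y_i)\cap Y_b$. A potential $g$ on $Y$ has summable variations ($g\in SV$) if $\sum_{n\ge2}V_n(g)<\infty$, $V_n(g)=\sup_{C_n}\sup_{x,y\in C_n}|g(x)-g(y)|$ over $n$-cylinders $C_n$. RPF measure: for $g\in SV$ with $P(g)=\log\lambda<\infty$, $L_gv(x)=\sum_{Fy=x}e^{g(y)}v(y)$; there are a conservative measure $m_g$ and a continuous $h>0$ with $L_g^*m_g=\lambda m_g$, $L_gh=\lambda h$, $\int h\,dm_g<\infty$; $\mu_g=h\,m_g$ (normalised) is the RPF measure of $g$. In particular $\mu_{\bar\phi}$ and $\mu_{\overline{\phi+s\psi}}$ are the RPF measures of $\bar\phi$ and $\overline{\phi+s\psi}$ for $F$. Basic setting: $\phi:X\to[-\infty,\infty)$ is null recurrent (there is a conservative $(\phi-P(\phi))$-conformal measure $m$ coming from the induced system, but no finite $f$-invariant measure $\ll m$), $P(\phi)=0$, $\bar\phi\in SV$; $\mu_\phi(A)=\sum_{k\ge0}\mu_{\bar\phi}(f^{-k}(A)\cap\{\tau>k\})$ is the infinite $\sigma$-finite $f$-invariant measure, with $\mu_\phi(Y)\in(0,\infty)$. $\mathcal B$ is the Banach space of bounded piecewise Hölder functions on $Y$ with norm $\|v\|=|v|_\infty+|v|_\theta$, $|v|_\theta=\sup_{A\in\mathcal A}\sup_{x\ne y\in A}|v(x)-v(y)|/\theta^{s(x,y)}$, $\theta\in(0,1)$, $s(x,y)$ the first $n$ with $F^nx,F^ny$ in different elements of $\mathcal A$. With $R$ the transfer operator of $F$ w.r.t.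 $\mu_{\bar\phi}$ and $R_nv=R(1_{\{\tau=n\}}v)$, known properties in this setting are: $\sum_{j>n}\|R_j\|_{\mathcal B\to\mathcal B}=O(n^{-\beta})$, and $1$ is a simple isolated eigenvalue of $R$ on $\mathcal B$. Admissible perturbation of heavy-tail type with exponent $\gamma\in(0,1]$: $\psi:X\to[-\infty,\infty)$ with $\bar\psi\in SV$; for some small $\delta>0$, $P(\overline{\phi+s\psi-P(\phi+s\psi)})=0$ for all $s\in[0,\delta)$; and $\bar\psi=C'-\psi_0$ with $0\le\psi_0\le \tilde C\tau^\gamma$, $C',\tilde C>0$, $\psi_0$ piecewise Hölder with the same $\theta$ as in $\mathcal B$. Uniform ratio condition: there is $C''>0$ with $$\lim_{n\to\infty}\frac{\mu_{\overline{\phi+s\psi}}(\tau=n)}{e^{s\psi_n}\mu_{\bar\phi}(\tau=n)}=C''\quad\text{uniformly in }s,$$ where $\psi_n$ denotes the value on $\{\tau=n\}$ of the ergodic sum $\sum_{j=0}^{n-1}\psi\circ f^j=\bar\psi$. *)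

theory Defs
  imports "HOL-Probability.Probability"
begin

section \<open>Entropy and pressure\<close>

(* For C_n in "cylinders T Z xi n" the k-th iterate (k < n) stays in one element of xi.  If xi is a
   partition of Z this is the join of T^{-k} xi, k < n, possibly together with the empty set. *)
definition cylinders :: "('a \<Rightarrow> 'a) \<Rightarrow> 'a set \<Rightarrow> 'a set set \<Rightarrow> nat \<Rightarrow> 'a set set" where
  "cylinders T Z \<xi> n =
     {C. \<exists>a. (\<forall>k<n. a k \<in> \<xi>) \<and> C = {x \<in> Z. \<forall>k<n. (T ^^ k) x \<in> a k}}"

definition partition_entropy :: "'a measure \<Rightarrow> 'a set set \<Rightarrow> real" where
  "partition_entropy \<mu> \<xi> = - (\<Sum>C\<in>\<xi>. measure \<mu> C * ln (measure \<mu> C))"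

(* Kolmogorov-Sinai entropy of a T-invariant probability measure. *)
definition ks_entropy :: "'a measure \<Rightarrow> ('a \<Rightarrow> 'a) \<Rightarrow> ereal" where
  "ks_entropy \<mu> T =
     (SUP \<xi>\<in>{\<xi>. finite \<xi> \<and> \<xi> \<subseteq> sets \<mu> \<and> partition_on (space \<mu>) \<xi>}.
        ereal (lim (\<lambda>n. partition_entropy \<mu> (cylinders T (space \<mu>) \<xi> n) / real n)))"

definition invariant_probs :: "'a measure \<Rightarrow> ('a \<Rightarrow> 'a) \<Rightarrow> 'a measure set" where
  "invariant_probs N T =
     {\<mu>. prob_space \<mu> \<and> sets \<mu> = sets N \<and> T \<in> measurable N N \<and> distr \<mu> N T = \<mu>}"

(* Integral of an extended-real function whose negative part is integrable. *)
definition ereal_integral :: "'a measure \<Rightarrow> ('a \<Rightarrow> ereal) \<Rightarrow> ereal" where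
  "ereal_integral \<mu> g =
     enn2ereal (\<integral>\<^sup>+x. e2ennreal (g x) \<partial>\<mu>) - enn2ereal (\<integral>\<^sup>+x. e2ennreal (- g x) \<partial>\<mu>)"

(* e2ennreal cuts off at 0, so the side condition says that the integral of the negative part of
   g is finite, i.e. that the integral of g exists and is not -infinity. *)
definition pressure :: "'a measure \<Rightarrow> ('a \<Rightarrow> 'a) \<Rightarrow> ('a \<Rightarrow> ereal) \<Rightarrow> ereal" where
  "pressure N T g =
     (SUP \<mu>\<in>{\<mu> \<in> invariant_probs N T. (\<integral>\<^sup>+x. e2ennreal (- g x) \<partial>\<mu>) < \<infinity>}.
        ks_entropy \<mu> T + ereal_integral \<mu> g)"

section \<open>First return maps\<close>

definition return_time :: "('a \<Rightarrow> 'a) \<Rightarrow> 'a set \<Rightarrow> 'a \<Rightarrow> nat" where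
  "return_time f Y x = (LEAST n. 1 \<le> n \<and> (f ^^ n) x \<in> Y)"

definition first_return :: "('a \<Rightarrow> 'a) \<Rightarrow> 'a set \<Rightarrow> 'a \<Rightarrow> 'a" where
  "first_return f Y x = (f ^^ return_time f Y x) x"

definition induced :: "('a \<Rightarrow> 'a) \<Rightarrow> 'a set \<Rightarrow> ('a \<Rightarrow> ereal) \<Rightarrow> 'a \<Rightarrow> ereal" where
  "induced f Y g x = (\<Sum>j<return_time f Y x. g ((f ^^ j) x))"

section \<open>Regularity along a partition\<close>

(* Since -infinity - (-infinity) = infinity in ereal, taking x = y shows that V_n is infinite as
   soon as g takes an infinite value; hence summable variations force g to be finite on Y. *)
definition variation ::
  "('a \<Rightarrow> 'a) \<Rightarrow> 'a set \<Rightarrow> 'a set set \<Rightarrow> ('a \<Rightarrow> ereal) \<Rightarrow> nat \<Rightarrow> ennreal" where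
  "variation T Y \<A> g n =
     (SUP C\<in>cylinders T Y \<A> n. SUP x\<in>C. SUP y\<in>C. e2ennreal \<bar>g x - g y\<bar>)"

definition summable_variations ::
  "('a \<Rightarrow> 'a) \<Rightarrow> 'a set \<Rightarrow> 'a set set \<Rightarrow> ('a \<Rightarrow> ereal) \<Rightarrow> bool" where
  "summable_variations T Y \<A> g \<longleftrightarrow> (\<Sum>n. variation T Y \<A> g (n + 2)) < \<infinity>"

(* Continuity on Y for the topology generated by the cylinders. *)
definition cylinder_continuous ::
  "('a \<Rightarrow> 'a) \<Rightarrow> 'a set \<Rightarrow> 'a set set \<Rightarrow> ('a \<Rightarrow> real) \<Rightarrow> bool" where
  "cylinder_continuous T Y \<A> h \<longleftrightarrow>
     (\<forall>x\<in>Y. \<forall>\<epsilon>>0. \<exists>n. \<forall>C\<in>cylinders T Y \<A> n. x \<in> C \<longrightarrow> (\<forall>y\<in>C. \<bar>h y - h x\<bar> < \<epsilon>))"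

definition separated_at :: "('a \<Rightarrow> 'a) \<Rightarrow> 'a set set \<Rightarrow> 'a \<Rightarrow> 'a \<Rightarrow> nat \<Rightarrow> bool" where
  "separated_at T \<A> x y n \<longleftrightarrow> \<not> (\<exists>A\<in>\<A>. (T ^^ n) x \<in> A \<and> (T ^^ n) y \<in> A)"

(* theta ^ s(x,y), with value 0 when x and y are never separated (s(x,y) = infinity). *)
definition theta_power :: "('a \<Rightarrow> 'a) \<Rightarrow> 'a set set \<Rightarrow> real \<Rightarrow> 'a \<Rightarrow> 'a \<Rightarrow> ennreal" where
  "theta_power T \<A> \<theta> x y =
     (if \<exists>n. separated_at T \<A> x y n then ennreal (\<theta> ^ (LEAST n. separated_at T \<A> x y n)) else 0)"

(* In ennreal, 0 / 0 = 0 and a / 0 = infinity for a > 0. *)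
definition holder_seminorm ::
  "('a \<Rightarrow> 'a) \<Rightarrow> 'a set set \<Rightarrow> real \<Rightarrow> ('a \<Rightarrow> 'b::real_normed_vector) \<Rightarrow> ennreal" where
  "holder_seminorm T \<A> \<theta> v =
     (SUP A\<in>\<A>. SUP x\<in>A. SUP y\<in>A - {x}. ennreal (norm (v x - v y)) / theta_power T \<A> \<theta> x y)"

definition holder_norm ::
  "('a \<Rightarrow> 'a) \<Rightarrow> 'a set \<Rightarrow> 'a set set \<Rightarrow> real \<Rightarrow> ('a \<Rightarrow> 'b::real_normed_vector) \<Rightarrow> ennreal" where
  "holder_norm T Y \<A> \<theta> v = (SUP x\<in>Y. ennreal (norm (v x))) + holder_seminorm T \<A> \<theta> v"

(* The Banach space B; functions on Y are extended by 0 so that they are determined by their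
   values on Y, and they are complex-valued because spectra are considered. *)
definition holder_space ::
  "('a \<Rightarrow> 'a) \<Rightarrow> 'a set \<Rightarrow> 'a set set \<Rightarrow> real \<Rightarrow> ('a \<Rightarrow> complex) set" where
  "holder_space T Y \<A> \<theta> = {v. (\<forall>x. x \<notin> Y \<longrightarrow> v x = 0) \<and> holder_norm T Y \<A> \<theta> v < \<infinity>}"

definition holder_opnorm ::
  "('a \<Rightarrow> 'a) \<Rightarrow> 'a set \<Rightarrow> 'a set set \<Rightarrow> real \<Rightarrow> (('a \<Rightarrow> complex) \<Rightarrow> ('a \<Rightarrow> complex)) \<Rightarrow> ennreal" where
  "holder_opnorm T Y \<A> \<theta> S =
     (SUP v\<in>{v \<in> holder_space T Y \<A> \<theta>. holder_norm T Y \<A> \<theta> v \<le> 1}. holder_norm T Y \<A> \<theta> (S v))"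

section \<open>Transfer operators and RPF measures\<close>

definition ereal_exp :: "ereal \<Rightarrow> ennreal" where
  "ereal_exp t = (case t of ereal r \<Rightarrow> ennreal (exp r) | PInfty \<Rightarrow> \<infinity> | MInfty \<Rightarrow> 0)"

definition ruelle_operator ::
  "('a \<Rightarrow> 'a) \<Rightarrow> 'a set \<Rightarrow> ('a \<Rightarrow> ereal) \<Rightarrow> ('a \<Rightarrow> ennreal) \<Rightarrow> 'a \<Rightarrow> ennreal" where
  "ruelle_operator T Y g v x = (\<Sum>\<^sub>\<infinity>y\<in>{y \<in> Y. T y = x}. ereal_exp (g y) * v y)"

(* Every wandering set is a null set. *)
definition conservative :: "('a \<Rightarrow> 'a) \<Rightarrow> 'a measure \<Rightarrow> bool" where
  "conservative T m \<longleftrightarrow>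
     (\<forall>W\<in>sets m. disjoint_family (\<lambda>n. (T ^^ n) -` W \<inter> space m) \<longrightarrow> emeasure m W = 0)"

(* The condition that T ` A is measurable is automatic on standard Borel spaces. *)
definition conformal :: "('a \<Rightarrow> 'a) \<Rightarrow> ('a \<Rightarrow> ereal) \<Rightarrow> 'a measure \<Rightarrow> bool" where
  "conformal T g m \<longleftrightarrow>
     (\<forall>A\<in>sets m. inj_on T A \<and> T ` A \<in> sets m \<longrightarrow>
        emeasure m (T ` A) = (\<integral>\<^sup>+x\<in>A. ereal_exp (- g x) \<partial>m))"

(* N is a measurable space with underlying set Y; L* m = lam m is tested on nonnegative
   measurable functions. *)
definition rpf_data ::
  "'a measure \<Rightarrow> ('a \<Rightarrow> 'a) \<Rightarrow> 'a set set \<Rightarrow> ('a \<Rightarrow> ereal) \<Rightarrow> real \<Rightarrow> 'a measure \<Rightarrow> ('a \<Rightarrow> real) \<Rightarrow> bool"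
  where
  "rpf_data N T \<A> g lam m h \<longleftrightarrow>
     summable_variations T (space N) \<A> g \<and>
     0 < lam \<and> pressure N T g = ereal (ln lam) \<and>
     sets m = sets N \<and> conservative T m \<and>
     (\<forall>x\<in>space N. 0 < h x) \<and> cylinder_continuous T (space N) \<A> h \<and>
     (\<forall>v\<in>borel_measurable N.
        (\<integral>\<^sup>+x. ruelle_operator T (space N) g v x \<partial>m) = ennreal lam * (\<integral>\<^sup>+x. v x \<partial>m)) \<and>
     (\<forall>x\<in>space N. ruelle_operator T (space N) g (\<lambda>y. ennreal (h y)) x = ennreal (lam * h x)) \<and>
     0 < (\<integral>\<^sup>+x. ennreal (h x) \<partial>m) \<and> (\<integral>\<^sup>+x. ennreal (h x) \<partial>m) < \<infinity>"

definition normalised_density :: "'a measure \<Rightarrow> ('a \<Rightarrow> real) \<Rightarrow> 'a measure" where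
  "normalised_density m h = density m (\<lambda>x. ennreal (h x) / (\<integral>\<^sup>+y. ennreal (h y) \<partial>m))"

definition rpf_measure ::
  "'a measure \<Rightarrow> ('a \<Rightarrow> 'a) \<Rightarrow> 'a set set \<Rightarrow> ('a \<Rightarrow> ereal) \<Rightarrow> 'a measure \<Rightarrow> bool" where
  "rpf_measure N T \<A> g \<mu> \<longleftrightarrow> (\<exists>lam m h. rpf_data N T \<A> g lam m h \<and> \<mu> = normalised_density m h)"

(* The transfer operator with respect to mu, acting on a function space V:
   it is dual to composition with T. *)
definition transfer_operator_on ::
  "('a \<Rightarrow> complex) set \<Rightarrow> 'a measure \<Rightarrow> ('a \<Rightarrow> 'a) \<Rightarrow> (('a \<Rightarrow> complex) \<Rightarrow> ('a \<Rightarrow> complex)) \<Rightarrow> bool" where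
  "transfer_operator_on V \<mu> T R \<longleftrightarrow>
     R ` V \<subseteq> V \<and>
     (\<forall>u\<in>V. \<forall>v\<in>V. \<forall>a b. R (\<lambda>x. a * u x + b * v x) = (\<lambda>x. a * R u x + b * R v x)) \<and>
     (\<forall>v\<in>V. \<forall>w\<in>borel_measurable \<mu>. bounded (w ` space \<mu>) \<longrightarrow>
        (\<integral>x. R v x * w x \<partial>\<mu>) = (\<integral>x. v x * w (T x) \<partial>\<mu>))"

(* On a Banach space a bijective bounded operator has a bounded inverse. *)
definition spectrum_on ::
  "('a \<Rightarrow> complex) set \<Rightarrow> (('a \<Rightarrow> complex) \<Rightarrow> ('a \<Rightarrow> complex)) \<Rightarrow> complex set" where
  "spectrum_on V R = {z. \<not> bij_betw (\<lambda>v x. R v x - z * v x) V V}"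

(* Simple: all generalised eigenvectors are multiples of one eigenvector. *)
definition simple_isolated_eigenvalue ::
  "('a \<Rightarrow> complex) set \<Rightarrow> (('a \<Rightarrow> complex) \<Rightarrow> ('a \<Rightarrow> complex)) \<Rightarrow> complex \<Rightarrow> bool" where
  "simple_isolated_eigenvalue V R z \<longleftrightarrow>
     (\<exists>\<epsilon>>0. spectrum_on V R \<inter> ball z \<epsilon> = {z}) \<and>
     (\<exists>e\<in>V. e \<noteq> (\<lambda>x. 0) \<and>
        (\<forall>k\<ge>1. {v \<in> V. ((\<lambda>v x. R v x - z * v x) ^^ k) v = (\<lambda>x. 0)} = range (\<lambda>a x. a * e x)))"

section \<open>The setting\<close>

(* BIP is stated with a finite subset of the partition in place of the indices 1, ..., N. *)
locale markov_first_return =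
  fixes M :: "'a measure" and f :: "'a \<Rightarrow> 'a" and Y :: "'a set" and \<A> :: "'a set set"
  assumes f_measurable: "f \<in> measurable M M"
    and Y_sets: "Y \<in> sets M" and Y_nonempty: "Y \<noteq> {}"
    and returns: "\<forall>x\<in>Y. \<exists>n\<ge>1. (f ^^ n) x \<in> Y"
    and countable_partition: "countable \<A>" "\<A> \<subseteq> sets M" "partition_on Y \<A>"
    and injective_branches: "\<forall>A\<in>\<A>. inj_on (first_return f Y) A"
    and constant_return_time: "\<forall>A\<in>\<A>. \<forall>x\<in>A. \<forall>y\<in>A. return_time f Y x = return_time f Y y"
    and markov: "\<forall>A\<in>\<A>. \<forall>B\<in>\<A>. A \<inter> first_return f Y ` B = {} \<or> A \<subseteq> first_return f Y ` B"
    and big_image_preimage: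
      "\<exists>\<N>\<subseteq>\<A>. finite \<N> \<and>
         (\<forall>A\<in>\<A>. \<exists>B\<in>\<N>. \<exists>C\<in>\<N>. first_return f Y ` B \<inter> A \<noteq> {} \<and> first_return f Y ` A \<inter> C \<noteq> {})"
begin

abbreviation \<tau> :: "'a \<Rightarrow> nat" where "\<tau> \<equiv> return_time f Y"
abbreviation F :: "'a \<Rightarrow> 'a" where "F \<equiv> first_return f Y"
abbreviation MY :: "'a measure" where "MY \<equiv> restrict_space M Y"

end

(* The conformal measure of phi comes from the induced system: its restriction to Y is the
   eigenmeasure defining the RPF measure mu of the induced potential. *)
definition null_recurrent ::
  "'a measure \<Rightarrow> ('a \<Rightarrow> 'a) \<Rightarrow> 'a set \<Rightarrow> 'a set set \<Rightarrow> ('a \<Rightarrow> ereal) \<Rightarrow> 'a measure \<Rightarrow> bool" where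
  "null_recurrent M f Y \<A> \<phi> \<mu> \<longleftrightarrow>
     (\<exists>m lam h. sets m = sets M \<and> conservative f m \<and>
        conformal f (\<lambda>x. \<phi> x - pressure M f \<phi>) m \<and>
        rpf_data (restrict_space M Y) (first_return f Y) \<A>
          (induced f Y (\<lambda>x. \<phi> x - pressure M f \<phi>)) lam (restrict_space m Y) h \<and>
        \<mu> = normalised_density (restrict_space m Y) h \<and>
        \<not> (\<exists>\<nu>. finite_measure \<nu> \<and> sets \<nu> = sets M \<and> emeasure \<nu> (space M) \<noteq> 0 \<and>
              distr \<nu> M f = \<nu> \<and> absolutely_continuous m \<nu>))"

(* The f-invariant measure obtained by spreading the F-invariant measure mu along the tower. *)
definition lifted_measure :: "'a measure \<Rightarrow> ('a \<Rightarrow> 'a) \<Rightarrow> 'a set \<Rightarrow> 'a measure \<Rightarrow> 'a measure" where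
  "lifted_measure M f Y \<mu> =
     measure_of (space M) (sets M)
       (\<lambda>A. \<Sum>k. emeasure \<mu> {x \<in> Y. (f ^^ k) x \<in> A \<and> k < return_time f Y x})"

(* mu is the RPF measure of the induced potential of phi. *)
locale basic_setting = markov_first_return M f Y \<A>
  for M :: "'a measure" and f :: "'a \<Rightarrow> 'a" and Y :: "'a set" and \<A> :: "'a set set" +
  fixes \<phi> :: "'a \<Rightarrow> ereal" and \<mu> :: "'a measure"
    and \<theta> \<beta> :: real and R :: "('a \<Rightarrow> complex) \<Rightarrow> ('a \<Rightarrow> complex)"
  assumes phi_measurable: "\<phi> \<in> borel_measurable M"
    and phi_less_infinity: "\<forall>x\<in>space M. \<phi> x < \<infinity>"
    and pressure_phi: "pressure M f \<phi> = 0"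
    and summable_variations_phi: "summable_variations F Y \<A> (induced f Y \<phi>)"
    and rpf_phi: "rpf_measure MY F \<A> (induced f Y \<phi>) \<mu>"
    and null_recurrent_phi: "null_recurrent M f Y \<A> \<phi> \<mu>"
    and lifted_sigma_finite: "sigma_finite_measure (lifted_measure M f Y \<mu>)"
    and lifted_invariant: "distr (lifted_measure M f Y \<mu>) M f = lifted_measure M f Y \<mu>"
    and lifted_infinite: "emeasure (lifted_measure M f Y \<mu>) (space M) = \<infinity>"
    and lifted_Y: "0 < emeasure (lifted_measure M f Y \<mu>) Y" "emeasure (lifted_measure M f Y \<mu>) Y < \<infinity>"
    and theta: "0 < \<theta>" "\<theta> < 1"
    and R_transfer: "transfer_operator_on (holder_space F Y \<A> \<theta>) \<mu> F R"
    and R_tails: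
      "\<exists>K. \<forall>n\<ge>1.
         (\<Sum>j. holder_opnorm F Y \<A> \<theta> (\<lambda>v. R (\<lambda>x. of_bool (\<tau> x = n + 1 + j) * v x)))
           \<le> ennreal (K * real n powr (- \<beta>))"
    and R_eigenvalue: "simple_isolated_eigenvalue (holder_space F Y \<A> \<theta>) R 1"

(* Finiteness of P(phi + s psi) is implicit in subtracting it from the potential. *)
locale admissible_perturbation = basic_setting M f Y \<A> \<phi> \<mu> \<theta> \<beta> R
  for M :: "'a measure" and f :: "'a \<Rightarrow> 'a" and Y :: "'a set" and \<A> :: "'a set set"
    and \<phi> :: "'a \<Rightarrow> ereal" and \<mu> :: "'a measure"
    and \<theta> \<beta> :: real and R :: "('a \<Rightarrow> complex) \<Rightarrow> ('a \<Rightarrow> complex)" +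
  fixes \<psi> :: "'a \<Rightarrow> ereal" and \<psi>\<^sub>0 :: "'a \<Rightarrow> real" and \<gamma> \<delta> C' Ct :: real
  assumes psi_measurable: "\<psi> \<in> borel_measurable M"
    and psi_less_infinity: "\<forall>x\<in>space M. \<psi> x < \<infinity>"
    and summable_variations_psi: "summable_variations F Y \<A> (induced f Y \<psi>)"
    and gamma: "0 < \<gamma>" "\<gamma> \<le> 1"
    and delta: "0 < \<delta>"
    and pressure_finite: "\<forall>s\<in>{0..<\<delta>}. \<bar>pressure M f (\<lambda>x. \<phi> x + ereal s * \<psi> x)\<bar> \<noteq> \<infinity>"
    and pressure_induced:
      "\<forall>s\<in>{0..<\<delta>}. pressure MY F (induced f Y
         (\<lambda>x. \<phi> x + ereal s * \<psi> x - pressure M f (\<lambda>x. \<phi> x + ereal s * \<psi> x))) = 0"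
    and constants: "0 < C'" "0 < Ct"
    and psi_induced: "\<forall>x\<in>Y. induced f Y \<psi> x = ereal (C' - \<psi>\<^sub>0 x)"
    and psi0_bounds: "\<forall>x\<in>Y. 0 \<le> \<psi>\<^sub>0 x \<and> \<psi>\<^sub>0 x \<le> Ct * real (\<tau> x) powr \<gamma>"
    and psi0_holder: "holder_seminorm F \<A> \<theta> \<psi>\<^sub>0 < \<infinity>"

(* psi_n is the value of the induced potential at a point of {tau = n}; if that value depends on
   the point, the limit is uniform in the point as well.  At s = 0 the ratio is 1, so only s > 0 is
   considered. *)
definition uniform_ratio ::
  "('a \<Rightarrow> 'a) \<Rightarrow> 'a set \<Rightarrow> ('a \<Rightarrow> ereal) \<Rightarrow> real \<Rightarrow> 'a measure \<Rightarrow> (real \<Rightarrow> 'a measure) \<Rightarrow> real \<Rightarrow> bool"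
  where
  "uniform_ratio f Y \<psi> \<delta> \<mu> \<mu>s C'' \<longleftrightarrow>
     (\<forall>\<epsilon>>0. \<forall>\<^sub>F n in sequentially. \<forall>s\<in>{0<..<\<delta>}. \<forall>x\<in>{x \<in> Y. return_time f Y x = n}.
        \<bar>measure (\<mu>s s) {y \<in> Y. return_time f Y y = n} /
           (exp (s * real_of_ereal (induced f Y \<psi> x)) * measure \<mu> {y \<in> Y. return_time f Y y = n})
         - C''\<bar> < \<epsilon>)"

end

theory Submission
  imports Defs
begin

text \<open>
  On \<open>{a < \<tau> \<le> 2 a}\<close> with \<open>a\<close> of order \<open>s powr (- 1 / \<gamma>)\<close> the weight \<open>exp (s \<psi>\<^sub>n)\<close> is at least
  \<open>exp (- Ct)\<close>, so there the perturbed measures dominate a multiple of \<open>\<mu>\<close> uniformly in \<open>s\<close>, and this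
  part of \<open>Y\<close> alone contributes \<open>a (\<mu>(\<tau> > a) - \<mu>(\<tau> > 2 a))\<close>, which is of order
  \<open>a powr (1 - \<beta>)\<close>, to the expectation of \<open>\<tau>\<close>. As the constant is not required to be sharp, the
  error term \<open>r\<close> can be taken to be \<open>0\<close>.
\<close>

section \<open>Measurability of the levels of the return time\<close>

lemma sets_rpf_measure: "rpf_measure N T \<A> g \<mu> \<Longrightarrow> sets \<mu> = sets N"
  by (auto simp: rpf_measure_def rpf_data_def normalised_density_def)

text \<open>Since \<open>\<tau>\<close> is constant on each partition element, such a set is a union
  of elements of the countable partition.\<close>

lemma (in markov_first_return) return_time_level_sets: "{x \<in> Y. P (\<tau> x)} \<in> sets MY"
proof -
  let ?\<B> = "{A \<in> \<A>. \<exists>x\<in>A. P (\<tau> x)}"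
  have "{x \<in> Y. P (\<tau> x)} = \<Union>?\<B>"
    using countable_partition(3) constant_return_time unfolding partition_on_def by (auto 4 4)
  moreover have "\<Union>?\<B> \<in> sets M"
    using countable_partition by (intro sets.countable_Union) (auto intro: countable_subset)
  ultimately show ?thesis
    using Y_sets by (auto simp: sets_restrict_space_iff)
qed

section \<open>Contribution of a block of levels, and the size of a tail difference\<close>

text \<open>On the levels \<open>n\<close> with \<open>a < n\<close> and \<open>n \<le> b\<close>
  the integrand exceeds \<open>a\<close> and \<open>Q\<close> dominates \<open>k\<close> times
  \<open>P\<close>; the \<open>P\<close>-masses of these levels add up to the difference of the two
  tails. Neither measure is assumed to be finite, only the tail of \<open>P\<close> beyond
  \<open>a\<close>.\<close>

lemma nn_integral_ge_tail_difference:
  fixes g :: "'a \<Rightarrow> nat"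
  assumes P: "\<And>A. {x \<in> Y. g x \<in> A} \<in> sets P" and Q: "\<And>A. {x \<in> Y. g x \<in> A} \<in> sets Q"
    and fin: "emeasure P {x \<in> Y. a < g x} \<noteq> \<infinity>"
    and "a \<le> b" and "0 \<le> k"
    and k: "\<And>n. a < n \<Longrightarrow> n \<le> b \<Longrightarrow>
      k * measure P {x \<in> Y. g x = n} \<le> measure Q {x \<in> Y. g x = n}"
  shows "ennreal (a * k * (measure P {x \<in> Y. a < g x} - measure P {x \<in> Y. b < g x}))
    \<le> (\<integral>\<^sup>+x. of_nat (g x) \<partial>Q)"
proof -
  let ?L = "\<lambda>n. {x \<in> Y. g x = n}"
  have LP: "?L n \<in> sets P" and LQ: "?L n \<in> sets Q" for n
    using P[of "{n}"] Q[of "{n}"] by auto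
  have tail: "{x \<in> Y. c < g x} \<in> sets P" for c
    using P[of "{c<..}"] by auto
  \<comment> \<open>\<open>measure\<close> is additive only over sets of finite
    \<open>emeasure\<close>; these levels lie in the finite tail beyond \<open>a\<close>.\<close>
  have finL: "emeasure P (?L n) \<noteq> \<infinity>" if "n \<in> {a<..b}" for n
  proof -
    have "?L n \<subseteq> {x \<in> Y. a < g x}"
      using that by auto
    from emeasure_mono[OF this tail] show ?thesis
      using fin by (auto simp: top_unique)
  qed
  have "measure P {x \<in> Y. a < g x} - measure P {x \<in> Y. b < g x}
      = measure P ({x \<in> Y. a < g x} - {x \<in> Y. b < g x})"
    using \<open>a \<le> b\<close> fin tail by (subst measure_Diff) auto
  also have "{x \<in> Y. a < g x} - {x \<in> Y. b < g x} = (\<Union>n\<in>{a<..b}. ?L n)"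
    by auto
  also have "measure P \<dots> = (\<Sum>n\<in>{a<..b}. measure P (?L n))"
    using LP finL by (intro measure_finite_Union) (auto simp: disjoint_family_on_def)
  finally have "a * k * (measure P {x \<in> Y. a < g x} - measure P {x \<in> Y. b < g x})
      = (\<Sum>n\<in>{a<..b}. a * (k * measure P (?L n)))"
    by (simp add: sum_distrib_left mult.assoc)
  also have "\<dots> \<le> (\<Sum>n\<in>{a<..b}. n * measure Q (?L n))"
    using k \<open>0 \<le> k\<close> by (intro sum_mono mult_mono) auto
  finally have "ennreal (a * k * (measure P {x \<in> Y. a < g x} - measure P {x \<in> Y. b < g x}))
      \<le> (\<Sum>n\<in>{a<..b}. of_nat n * ennreal (measure Q (?L n)))"
    by (simp add: ennreal_leI ennreal_of_nat_eq_real_of_nat flip: ennreal_mult)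
  \<comment> \<open>This also holds on a level of infinite mass, where \<open>measure\<close> takes
    the default value 0.\<close>
  also have "\<dots> \<le> (\<Sum>n\<in>{a<..b}. of_nat n * emeasure Q (?L n))"
    by (intro sum_mono mult_left_mono) (auto simp: measure_def ennreal_enn2real_if)
  also have "\<dots> = (\<integral>\<^sup>+x. (\<Sum>n\<in>{a<..b}. of_nat n * indicator (?L n) x) \<partial>Q)"
    using LQ by (subst nn_integral_sum) (auto simp: nn_integral_cmult_indicator)
  also have "\<dots> \<le> (\<integral>\<^sup>+x. of_nat (g x) \<partial>Q)"
  proof (rule nn_integral_mono)
    fix x
    \<comment> \<open>The levels are disjoint, so at most the term with \<open>n = g x\<close>
      survives.\<close>
    have "(\<Sum>n\<in>{a<..b}. of_nat n * indicator (?L n) x)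
        \<le> (\<Sum>n\<in>{a<..b}. if n = g x then of_nat (g x) else (0::ennreal))"
      by (intro sum_mono) (auto simp: indicator_def)
    also have "\<dots> \<le> of_nat (g x)"
      by simp
    finally show "(\<Sum>n\<in>{a<..b}. of_nat n * indicator (?L n) x) \<le> (of_nat (g x) :: ennreal)" .
  qed
  finally show ?thesis .
qed

text \<open>Divided by \<open>real n powr (- \<beta>)\<close>, the difference
  \<open>T n - T (2 * n)\<close> tends to \<open>c * (1 - 2 powr (- \<beta>))\<close>. This limit is
  positive because \<open>0 < \<beta>\<close>, so half of it is eventually a lower bound.\<close>

lemma tail_difference_lower_bound:
  fixes T :: "nat \<Rightarrow> real"
  assumes T: "T \<sim>[at_top] (\<lambda>n. c * real n powr (- \<beta>))" and "0 < c" and "0 < \<beta>"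
  shows "\<forall>\<^sub>F n in sequentially.
    c * (1 - 2 powr (- \<beta>)) / 2 * n powr (1 - \<beta>) \<le> n * (T n - T (2 * n))"
proof -
  have "(\<lambda>n. T n / (c * real n powr (- \<beta>))) \<longlonglongrightarrow> 1"
    using T by (rule asymp_equivD_strong)
      (use \<open>0 < c\<close> in \<open>auto intro: eventually_mono[OF eventually_gt_at_top[of 0]]\<close>)
  from tendsto_mult[OF this tendsto_const[of c]]
  have "(\<lambda>n. T n / (c * real n powr (- \<beta>)) * c) \<longlonglongrightarrow> 1 * c" .
  then have lim: "(\<lambda>n. T n / real n powr (- \<beta>)) \<longlonglongrightarrow> c"
    using \<open>0 < c\<close> by simp
  moreover have "filterlim (\<lambda>n::nat. 2 * n) at_top at_top"
    by (rule filterlim_subseq) (auto simp: strict_mono_def)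
  ultimately have "(\<lambda>n. T (2 * n) / real (2 * n) powr (- \<beta>)) \<longlonglongrightarrow> c"
    by (rule filterlim_compose)
  \<comment> \<open>The factor \<open>2 powr (- \<beta>)\<close> changes the normalisation of
    \<open>T (2 * n)\<close> from \<open>real (2 * n) powr (- \<beta>)\<close> to
    \<open>real n powr (- \<beta>)\<close>.\<close>
  from tendsto_diff[OF lim tendsto_mult[OF this tendsto_const[of "2 powr (- \<beta>)"]]]
  have "(\<lambda>n. T n / real n powr (- \<beta>) - T (2 * n) / real (2 * n) powr (- \<beta>) * 2 powr (- \<beta>))
      \<longlonglongrightarrow> c * (1 - 2 powr (- \<beta>))"
    by (simp only: right_diff_distrib mult_1_right)
  moreover have "c * (1 - 2 powr (- \<beta>)) / 2 < c * (1 - 2 powr (- \<beta>))"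
    using \<open>0 < c\<close> \<open>0 < \<beta>\<close> powr_less_mono[of "-\<beta>" 0 2] by simp
  ultimately have "\<forall>\<^sub>F n in sequentially. c * (1 - 2 powr (- \<beta>)) / 2
      < T n / real n powr (- \<beta>) - T (2 * n) / real (2 * n) powr (- \<beta>) * 2 powr (- \<beta>)"
    by (rule order_tendstoD)
  then show ?thesis
    using eventually_gt_at_top[of 0]
  proof eventually_elim
    case (elim n)
    have "c * (1 - 2 powr (- \<beta>)) / 2 < (T n - T (2 * n)) / real n powr (- \<beta>)"
      using elim by (simp add: powr_mult diff_divide_distrib)
    then have "c * (1 - 2 powr (- \<beta>)) / 2 * real n powr (- \<beta>) \<le> T n - T (2 * n)"
      using elim by (simp add: pos_less_divide_eq)
    from mult_left_mono[OF this, of "real n"] show ?case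
      using elim powr_add[of "real n" 1 "- \<beta>"] by (simp add: mult_ac)
  qed
qed

section \<open>Perturbed measures on the levels, and the choice of scale\<close>

text \<open>With tolerance \<open>C'' / 2\<close> the ratio stays above \<open>C'' / 2\<close>, and
  the upper bound on \<open>\<psi>\<^sub>0\<close> bounds the exponential weight from below. The
  threshold for \<open>n\<close> is the same for all \<open>s\<close>, which later allows
  \<open>n\<close> to grow as \<open>s\<close> tends to 0.\<close>

lemma (in admissible_perturbation) eventually_perturbed_level_ge:
  assumes ratio: "uniform_ratio f Y \<psi> \<delta> \<mu> \<mu>s C''" and "0 < C''"
  shows "\<forall>\<^sub>F n in sequentially. \<forall>s\<in>{0<..<\<delta>}.
    C'' / 2 * exp (- (s * (Ct * real n powr \<gamma>))) * measure \<mu> {x \<in> Y. \<tau> x = n}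
      \<le> measure (\<mu>s s) {x \<in> Y. \<tau> x = n}"
proof -
  have "0 < C'' / 2"
    using \<open>0 < C''\<close> by simp
  with ratio have "\<forall>\<^sub>F n in sequentially. \<forall>s\<in>{0<..<\<delta>}. \<forall>x\<in>{x \<in> Y. \<tau> x = n}.
      \<bar>measure (\<mu>s s) {y \<in> Y. \<tau> y = n} /
         (exp (s * real_of_ereal (induced f Y \<psi> x)) * measure \<mu> {y \<in> Y. \<tau> y = n}) - C''\<bar> < C'' / 2"
    unfolding uniform_ratio_def by blast
  then show ?thesis
  proof eventually_elim
    case (elim n)
    show ?case
    proof
      fix s assume s: "s \<in> {0<..<\<delta>}"
      let ?m = "measure \<mu> {x \<in> Y. \<tau> x = n}" and ?ms = "measure (\<mu>s s) {x \<in> Y. \<tau> x = n}"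
      show "C'' / 2 * exp (- (s * (Ct * real n powr \<gamma>))) * ?m \<le> ?ms"
      \<comment> \<open>A null level makes the left side 0. A level of nonzero measure is nonempty,
        and any of its points can be inserted in the ratio condition.\<close>
      proof (cases "?m = 0")
        case False
        then obtain x where x: "x \<in> Y" "\<tau> x = n"
          by (metis (mono_tags, lifting) Collect_empty_eq measure_empty)
        define w where "w = exp (s * real_of_ereal (induced f Y \<psi> x))"
        have "\<bar>?ms / (w * ?m) - C''\<bar> < C'' / 2"
          using elim s x unfolding w_def by blast
        then have "C'' / 2 < ?ms / (w * ?m)"
          by linarith
        moreover have "0 < ?m"
          using False by (simp add: zero_less_measure_iff)
        ultimately have "C'' / 2 * (w * ?m) \<le> ?ms"
          by (simp add: pos_less_divide_eq w_def)
        \<comment> \<open>The positive constant \<open>C'\<close> is dropped, which only lowers the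
          bound.\<close>
        moreover have "- (Ct * real n powr \<gamma>) \<le> C' - \<psi>\<^sub>0 x"
          using psi0_bounds x constants by fastforce
        then have "s * - (Ct * real n powr \<gamma>) \<le> s * (C' - \<psi>\<^sub>0 x)"
          using s by (intro mult_left_mono) auto
        then have "exp (- (s * (Ct * real n powr \<gamma>))) \<le> w"
          using x psi_induced by (simp add: w_def)
        then have "C'' / 2 * (exp (- (s * (Ct * real n powr \<gamma>))) * ?m) \<le> C'' / 2 * (w * ?m)"
          using \<open>0 < C''\<close> by (intro mult_left_mono mult_right_mono) auto
        ultimately show ?thesis
          by (simp add: mult.assoc)
      qed simp
    qed
  qed
qed

text \<open>The factors of the constant have separate sources: \<open>C'' / 2\<close> is the ratio
  bound, \<open>exp (- Ct)\<close> the weight where \<open>s * real n powr \<gamma>\<close> is at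
  most 1, \<open>c * (1 - 2 powr (- \<beta>)) / 2\<close> the tail difference, and
  \<open>4 powr (\<beta> - 1)\<close> the loss from rounding the scale.\<close>

lemma (in admissible_perturbation) expected_return_time_lower_bound:
  assumes rpf: "\<forall>s\<in>{0<..<\<delta>}.
      rpf_measure MY F \<A> (induced f Y (\<lambda>x. \<phi> x + ereal s * \<psi> x)) (\<mu>s s)"
    and ratio: "uniform_ratio f Y \<psi> \<delta> \<mu> \<mu>s C''" and "0 < C''"
    and tail: "(\<lambda>n. measure \<mu> {x \<in> Y. n < \<tau> x}) \<sim>[at_top] (\<lambda>n. c * real n powr (- \<beta>))"
    and "0 < c" and "0 < \<beta>" and "\<beta> < 1"
  shows "\<forall>\<^sub>F s in at_right 0.
    ennreal (C'' / 2 * exp (- Ct) * (c * (1 - 2 powr (- \<beta>)) / 2) * 4 powr (\<beta> - 1)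
        * s powr ((\<beta> - 1) / \<gamma>))
      \<le> (\<integral>\<^sup>+x. of_nat (\<tau> x) \<partial>(\<mu>s s))"
proof -
  define T where "T n = measure \<mu> {x \<in> Y. n < \<tau> x}" for n
  define D where "D = c * (1 - 2 powr (- \<beta>)) / 2"
  have "0 < D"
    using \<open>0 < c\<close> \<open>0 < \<beta>\<close> powr_less_mono[of "-\<beta>" 0 2] by (simp add: D_def)
  \<comment> \<open>Everything required of the left end of the block is stated for all
    \<open>s\<close> at once, so that a value depending on \<open>s\<close> can be
    substituted.\<close>
  define good where "good a \<longleftrightarrow> 0 < T a \<and> D * real a powr (1 - \<beta>) \<le> a * (T a - T (2 * a)) \<and>
    (\<forall>n>a. \<forall>s\<in>{0<..<\<delta>}.
      C'' / 2 * exp (- (s * (Ct * real n powr \<gamma>))) * measure \<mu> {x \<in> Y. \<tau> x = n}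
        \<le> measure (\<mu>s s) {x \<in> Y. \<tau> x = n})" for a
  \<comment> \<open>Asymptotically equivalent functions eventually have the same zeros, so the tail
    is eventually nonzero.\<close>
  have "\<forall>\<^sub>F n in sequentially. 0 < c * real n powr (- \<beta>)"
    using \<open>0 < c\<close> by (auto intro: eventually_mono[OF eventually_gt_at_top[of 0]])
  then have "\<forall>\<^sub>F n in sequentially. 0 < T n"
    using asymp_equiv_eventually_zeros[OF tail]
    by eventually_elim (auto simp: T_def zero_less_measure_iff)
  moreover have "\<forall>\<^sub>F n in sequentially. D * real n powr (1 - \<beta>) \<le> n * (T n - T (2 * n))"
    using tail_difference_lower_bound[OF tail \<open>0 < c\<close> \<open>0 < \<beta>\<close>] by (simp add: T_def D_def)
  moreover have "\<forall>\<^sub>F a in sequentially. \<forall>n>a. \<forall>s\<in>{0<..<\<delta>}.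
      C'' / 2 * exp (- (s * (Ct * real n powr \<gamma>))) * measure \<mu> {x \<in> Y. \<tau> x = n}
        \<le> measure (\<mu>s s) {x \<in> Y. \<tau> x = n}"
    using eventually_perturbed_level_ge[OF ratio \<open>0 < C''\<close>] unfolding eventually_sequentially
    by (meson less_imp_le le_trans)
  ultimately have good: "\<forall>\<^sub>F a in sequentially. good a"
    unfolding good_def by (intro eventually_conj)
  \<comment> \<open>\<open>X s\<close> is the scale at which
    \<open>s * X s powr \<gamma> = 1\<close>; halving it keeps the whole block up to
    \<open>2 * a s\<close> below that scale.\<close>
  define X where "X s = s powr (- 1 / \<gamma>)" for s :: real
  define a where "a s = nat \<lfloor>X s / 2\<rfloor>" for s :: real
  have X: "filterlim X at_top (at_right 0)"
    unfolding X_def using gamma by real_asymp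
  have "filterlim (\<lambda>s. X s / 2) at_top (at_right 0)"
    using filterlim_tendsto_pos_mult_at_top[OF tendsto_const[of "1/2"] _ X] by simp
  then have "filterlim a at_top (at_right 0)"
    unfolding a_def
    by (intro filterlim_compose[OF filterlim_nat_sequentially]
      filterlim_compose[OF filterlim_floor_sequentially])
  from eventually_compose_filterlim[OF good this]
  have "\<forall>\<^sub>F s in at_right 0. good (a s)" .
  moreover have "\<forall>\<^sub>F s in at_right 0. 4 \<le> X s"
    using X by (simp add: filterlim_at_top)
  moreover have "\<forall>\<^sub>F s in at_right 0. s \<in> {0<..<\<delta>}"
    using delta by (rule eventually_at_right_real)
  ultimately show ?thesis
  proof eventually_elim
    case (elim s)
    \<comment> \<open>For \<open>4 \<le> X s\<close> the floor of \<open>X s / 2\<close> is at least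
      \<open>X s / 2 - 1\<close>, hence at least \<open>X s / 4\<close>.\<close>
    have le: "real (2 * a s) \<le> X s" and ge: "X s / 4 \<le> real (a s)"
      using elim unfolding a_def by linarith+
    have "sets \<mu> = sets MY" and "sets (\<mu>s s) = sets MY"
      using sets_rpf_measure[OF rpf_phi] sets_rpf_measure[OF bspec[OF rpf]] elim by auto
    then have sets: "{x \<in> Y. \<tau> x \<in> A} \<in> sets \<mu>" "{x \<in> Y. \<tau> x \<in> A} \<in> sets (\<mu>s s)" for A
      using return_time_level_sets[of "\<lambda>n. n \<in> A"] by auto
    \<comment> \<open>a set of infinite \<open>emeasure\<close> has \<open>measure\<close> \<open>0\<close>, so positivity of the tail gives finiteness\<close>
    have fin: "emeasure \<mu> {x \<in> Y. a s < \<tau> x} \<noteq> \<infinity>"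
      using elim by (auto simp: good_def T_def measure_def)
    have level: "C'' / 2 * exp (- Ct) * measure \<mu> {x \<in> Y. \<tau> x = n}
        \<le> measure (\<mu>s s) {x \<in> Y. \<tau> x = n}" if n: "a s < n" "n \<le> 2 * a s" for n
    proof -
      have "real n powr \<gamma> \<le> X s powr \<gamma>"
        using n le gamma by (intro powr_mono2) auto
      also have "\<dots> = 1 / s"
        using elim gamma unfolding X_def powr_powr by (simp add: powr_minus_divide)
      finally have "s * real n powr \<gamma> \<le> 1"
        using elim by (simp add: field_simps)
      then have "Ct * (s * real n powr \<gamma>) \<le> Ct * 1"
        using constants by (intro mult_left_mono) auto
      then have "exp (- Ct) \<le> exp (- (s * (Ct * real n powr \<gamma>)))"
        by (simp add: mult.left_commute)
      then have "C'' / 2 * exp (- Ct) * measure \<mu> {x \<in> Y. \<tau> x = n}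
          \<le> C'' / 2 * exp (- (s * (Ct * real n powr \<gamma>))) * measure \<mu> {x \<in> Y. \<tau> x = n}"
        using \<open>0 < C''\<close> by (intro mult_left_mono mult_right_mono) auto
      also have "\<dots> \<le> measure (\<mu>s s) {x \<in> Y. \<tau> x = n}"
        using elim n by (auto simp: good_def)
      finally show ?thesis .
    qed
    have "ennreal (a s * (C'' / 2 * exp (- Ct)) * (T (a s) - T (2 * a s)))
        \<le> (\<integral>\<^sup>+x. of_nat (\<tau> x) \<partial>(\<mu>s s))"
      unfolding T_def
      by (rule nn_integral_ge_tail_difference[OF sets fin _ _ level]) (use \<open>0 < C''\<close> in simp_all)
    moreover have "C'' / 2 * exp (- Ct) * D * 4 powr (\<beta> - 1) * s powr ((\<beta> - 1) / \<gamma>)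
        \<le> a s * (C'' / 2 * exp (- Ct)) * (T (a s) - T (2 * a s))"
    proof -
      \<comment> \<open>The power of \<open>s\<close> is rewritten as a power of \<open>X s\<close>;
        its exponent \<open>1 - \<beta>\<close> is positive, so the lower bound on
        \<open>a s\<close> carries over.\<close>
      have "(\<beta> - 1) / \<gamma> = - 1 / \<gamma> * (1 - \<beta>)"
        using gamma by (simp add: field_simps)
      then have "s powr ((\<beta> - 1) / \<gamma>) = X s powr (1 - \<beta>)"
        unfolding X_def powr_powr by (rule arg_cong)
      moreover have "4 powr (\<beta> - 1) = 1 / (4 powr (1 - \<beta>) :: real)"
        using powr_minus_divide[of "4::real" "1 - \<beta>"] by (simp only: minus_diff_eq)
      ultimately have "4 powr (\<beta> - 1) * s powr ((\<beta> - 1) / \<gamma>) = X s powr (1 - \<beta>) / 4 powr (1 - \<beta>)"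
        by (simp only: times_divide_eq_left mult_1)
      also have "\<dots> = (X s / 4) powr (1 - \<beta>)"
        by (simp only: powr_divide)
      also have "\<dots> \<le> real (a s) powr (1 - \<beta>)"
        using ge elim \<open>\<beta> < 1\<close> by (intro powr_mono2) auto
      finally have "D * (4 powr (\<beta> - 1) * s powr ((\<beta> - 1) / \<gamma>)) \<le> D * real (a s) powr (1 - \<beta>)"
        using \<open>0 < D\<close> by (intro mult_left_mono) auto
      also have "\<dots> \<le> a s * (T (a s) - T (2 * a s))"
        using elim by (simp add: good_def)
      finally have "C'' / 2 * exp (- Ct) * (D * (4 powr (\<beta> - 1) * s powr ((\<beta> - 1) / \<gamma>)))
          \<le> C'' / 2 * exp (- Ct) * (a s * (T (a s) - T (2 * a s)))"
        using \<open>0 < C''\<close> by (intro mult_left_mono) auto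
      then show ?thesis
        by (simp add: mult_ac)
    qed
    ultimately show ?case
      unfolding D_def by (meson ennreal_leI order_trans)
  qed
qed

theorem lemma6p1:
  fixes \<beta> Ct C'' :: real
  assumes "0 < \<beta>" and "\<beta> < 1" and "0 < Ct" and "0 < C''"
  shows "\<exists>C :: real \<Rightarrow> real \<Rightarrow> real. \<forall>\<gamma> c. 0 < \<gamma> \<and> \<gamma> \<le> 1 \<and> 0 < c \<longrightarrow>
    0 < C \<gamma> c \<and>
    (\<forall>(M :: 'a measure) f Y \<A> \<phi> \<mu> \<theta> R \<psi> \<psi>\<^sub>0 \<delta> C' \<mu>s.
       admissible_perturbation M f Y \<A> \<phi> \<mu> \<theta> \<beta> R \<psi> \<psi>\<^sub>0 \<gamma> \<delta> C' Ct \<and>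
       (\<forall>s\<in>{0<..<\<delta>}. rpf_measure (restrict_space M Y) (first_return f Y) \<A>
          (induced f Y (\<lambda>x. \<phi> x + ereal s * \<psi> x)) (\<mu>s s)) \<and>
       uniform_ratio f Y \<psi> \<delta> \<mu> \<mu>s C'' \<and>
       (\<lambda>n. measure \<mu> {x \<in> Y. n < return_time f Y x}) \<sim>[at_top] (\<lambda>n. c * real n powr (- \<beta>))
       \<longrightarrow>
       (\<exists>r :: real \<Rightarrow> real. (r \<longlongrightarrow> 0) (at_right 0) \<and>
          (\<forall>\<^sub>F s in at_right 0.
             ennreal (C \<gamma> c * s powr ((\<beta> - 1) / \<gamma>) * (1 + r s))
               \<le> (\<integral>\<^sup>+x. of_nat (return_time f Y x) \<partial>(\<mu>s s)))))"
\<comment> \<open>The constant has to precede the system and the measures; it is built from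
  \<open>c\<close> and from \<open>\<beta>\<close>, \<open>Ct\<close> and \<open>C''\<close>, which
  are fixed beforehand.\<close>
proof (intro exI[of _ "\<lambda>\<gamma> c. C'' / 2 * exp (- Ct) * (c * (1 - 2 powr (- \<beta>)) / 2) * 4 powr (\<beta> - 1)"]
    allI impI conjI exI[of _ "\<lambda>_. 0"])
  fix \<gamma> c :: real
  assume "0 < \<gamma> \<and> \<gamma> \<le> 1 \<and> 0 < c"
  then show "0 < C'' / 2 * exp (- Ct) * (c * (1 - 2 powr (- \<beta>)) / 2) * 4 powr (\<beta> - 1)"
    using assms powr_less_mono[of "-\<beta>" 0 2] by simp
next
  fix \<gamma> c :: real and M :: "'a measure" and f Y \<A> \<phi> \<mu> \<theta> R \<psi> \<psi>\<^sub>0 \<delta> C' \<mu>s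
  let ?adm = "admissible_perturbation M f Y \<A> \<phi> \<mu> \<theta> \<beta> R \<psi> \<psi>\<^sub>0 \<gamma> \<delta> C' Ct"
    and ?rpf = "\<forall>s\<in>{0<..<\<delta>}. rpf_measure (restrict_space M Y) (first_return f Y) \<A>
      (induced f Y (\<lambda>x. \<phi> x + ereal s * \<psi> x)) (\<mu>s s)"
    and ?ratio = "uniform_ratio f Y \<psi> \<delta> \<mu> \<mu>s C''"
    and ?tail = "(\<lambda>n. measure \<mu> {x \<in> Y. n < return_time f Y x}) \<sim>[at_top] (\<lambda>n. c * real n powr (- \<beta>))"
  assume "0 < \<gamma> \<and> \<gamma> \<le> 1 \<and> 0 < c" and "?adm \<and> ?rpf \<and> ?ratio \<and> ?tail"
  then have "0 < c" and ?adm and ?rpf and ?ratio and ?tail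
    by blast+
  from admissible_perturbation.expected_return_time_lower_bound[OF \<open>?adm\<close> \<open>?rpf\<close> \<open>?ratio\<close>
      \<open>0 < C''\<close> \<open>?tail\<close> \<open>0 < c\<close> \<open>0 < \<beta>\<close> \<open>\<beta> < 1\<close>]
  show "\<forall>\<^sub>F s in at_right 0.
      ennreal (C'' / 2 * exp (- Ct) * (c * (1 - 2 powr (- \<beta>)) / 2) * 4 powr (\<beta> - 1)
          * s powr ((\<beta> - 1) / \<gamma>) * (1 + 0))
        \<le> (\<integral>\<^sup>+x. of_nat (return_time f Y x) \<partial>(\<mu>s s))"
    by (simp only: add_0_right mult_1_right)
qed (rule tendsto_const)

end
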